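(* For every $\{\text{triangle, co-diamond}\}$-free graph $G$ on $n$ vertices and for every $\ell\ge\chi(G)+1$, we have $\operatorname{diam}\mathcal{C}_\ell(G)\le\lfloor(5+1/2)n\rfloor$, unless $G$ is isomorphic to $K_{\ell,\ell}$ minus a perfect matching.
   Context: $\chi(G)$ is the chromatic number of $G$. The co-diamond is the complement of the diamond ($K_4$ minus an edge), i.e. the disjoint union of an edge and two isolated vertices. A graph is $\{\text{triangle, co-diamond}\}$-free if it has no induced subgraph isomorphic to a triangle or to the co-diamond. $\mathcal{C}_\ell(G)$ is the graph whose vertices are the proper vertex colourings of $G$ with colours from $\{1,\dots,\ell\}$, two being adjacent precisely when they differ in the colour of exactly one vertex; its diameter is the maximum distance between two of its vertices ($\infty$ if disconnected). *)

theory Defs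
  imports "Graph_Theory.Graph_Theory"
begin

text \<open>
  A finite simple graph is a \<^locale>\<open>pair_graph\<close>: each undirected edge \<open>uv\<close> is represented by
  the two arcs \<open>(u, v)\<close> and \<open>(v, u)\<close>.
\<close>

definition delete_edges :: "'a pair_pre_digraph \<Rightarrow> 'a rel \<Rightarrow> 'a pair_pre_digraph" where
  "delete_edges G M = \<lparr>pverts = pverts G, parcs = parcs G - M\<rparr>"

definition complement :: "'a pair_pre_digraph \<Rightarrow> 'a pair_pre_digraph" where
  "complement G = \<lparr>pverts = pverts G,
     parcs = {(u, v). u \<in> pverts G \<and> v \<in> pverts G \<and> u \<noteq> v \<and> (u, v) \<notin> parcs G}\<rparr>"

definition complete_graph :: "nat \<Rightarrow> nat pair_pre_digraph" where
  "complete_graph n = \<lparr>pverts = {..<n}, parcs = {(u, v). u < n \<and> v < n \<and> u \<noteq> v}\<rparr>"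

definition triangle_graph :: "nat pair_pre_digraph" where
  "triangle_graph = complete_graph 3"

definition diamond :: "nat pair_pre_digraph" where
  "diamond = delete_edges (complete_graph 4) {(0, 1), (1, 0)}"

definition co_diamond :: "nat pair_pre_digraph" where
  "co_diamond = complement diamond"

definition graph_iso :: "'a pair_pre_digraph \<Rightarrow> 'b pair_pre_digraph \<Rightarrow> bool" where
  "graph_iso G H \<longleftrightarrow> digraph_iso (with_proj G) (with_proj H)"

definition induced_free :: "'a pair_pre_digraph \<Rightarrow> 'b pair_pre_digraph \<Rightarrow> bool" where
  "induced_free H G \<longleftrightarrow>
     \<not> (\<exists>H'. induced_subgraph (with_proj H') (with_proj G) \<and> graph_iso H' H)"

definition complete_bipartite_graph :: "nat \<Rightarrow> nat \<Rightarrow> (nat + nat) pair_pre_digraph" where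
  "complete_bipartite_graph m n =
     (let U = Inl ` {..<m}; V = Inr ` {..<n}
      in \<lparr>pverts = U \<union> V, parcs = U \<times> V \<union> V \<times> U\<rparr>)"

definition perfect_matching :: "'a pair_pre_digraph \<Rightarrow> 'a rel \<Rightarrow> bool" where
  "perfect_matching G M \<longleftrightarrow>
     M \<subseteq> parcs G \<and> sym M \<and> (\<forall>v \<in> pverts G. \<exists>!w. (v, w) \<in> M)"

text \<open>
  Colourings are extensional functions, so that two colourings agreeing on all vertices of the
  graph are equal.
\<close>

definition colourings :: "nat \<Rightarrow> 'a pair_pre_digraph \<Rightarrow> ('a \<Rightarrow> nat) set" where
  "colourings l G = {c \<in> pverts G \<rightarrow>\<^sub>E {1..l}. \<forall>(u, v) \<in> parcs G. c u \<noteq> c v}"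

definition chromatic_number :: "'a pair_pre_digraph \<Rightarrow> nat" where
  "chromatic_number G = (LEAST k. colourings k G \<noteq> {})"

definition recolouring_graph :: "nat \<Rightarrow> 'a pair_pre_digraph \<Rightarrow> ('a \<Rightarrow> nat) pair_pre_digraph" where
  "recolouring_graph l G = \<lparr>pverts = colourings l G,
     parcs = {(c, d). c \<in> colourings l G \<and> d \<in> colourings l G \<and>
                      (\<exists>!v. v \<in> pverts G \<and> c v \<noteq> d v)}\<rparr>"

text \<open>
  With unit weights, the shortest-path cost \<^const>\<open>wf_digraph.\<mu>\<close> is the graph distance; it is
  \<open>\<infinity>\<close> when there is no walk.
\<close>

definition diameter :: "'a pair_pre_digraph \<Rightarrow> ereal" where
  "diameter G =
     (SUP u \<in> pverts G. SUP v \<in> pverts G. wf_digraph.\<mu> (with_proj G) (\<lambda>_. 1) u v)"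

lemma complete_graph_K: "K\<^bsub>n\<^esub> (with_proj (complete_graph n))"
  by (auto simp: complete_digraph_pair_def complete_graph_def)

lemma complete_bipartite_graph_K: "K\<^bsub>m,n\<^esub> (with_proj (complete_bipartite_graph m n))"
  unfolding complete_bipartite_digraph_pair_def complete_bipartite_graph_def Let_def
  by (intro conjI exI[where x = "Inl ` {..<m}"] exI[where x = "Inr ` {..<n}"])
    (auto simp: card_image)

lemma co_diamond_eq: "co_diamond = \<lparr>pverts = {0, 1, 2, 3}, parcs = {(0, 1), (1, 0)}\<rparr>"
  by (auto simp: co_diamond_def complement_def diamond_def delete_edges_def complete_graph_def)

lemma pair_graph_recolouring_graph:
  assumes "pair_graph G"
  shows "pair_graph (recolouring_graph l G)"
proof -
  interpret pair_graph G by fact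
  have "finite (pverts G \<rightarrow>\<^sub>E {1..l})"
    by (intro finite_PiE) (auto simp: pair_finite_verts)
  then have fin: "finite (colourings l G)"
    by (rule finite_subset[rotated]) (auto simp: colourings_def)
  have "parcs (recolouring_graph l G) \<subseteq> colourings l G \<times> colourings l G"
    by (auto simp: recolouring_graph_def)
  then have fin': "finite (parcs (recolouring_graph l G))"
    using fin by (meson finite_SigmaI finite_subset)
  have sym: "sym (parcs (recolouring_graph l G))"
    by (rule symI) (auto simp: recolouring_graph_def eq_commute)
  show ?thesis
    using fin fin' sym
    by unfold_locales (auto simp: recolouring_graph_def symmetric_def)
qed

lemma diameter_le_iff:
  assumes "pair_wf_digraph G"
  shows "diameter G \<le> ereal (real k) \<longleftrightarrow>
    (\<forall>u \<in> pverts G. \<forall>v \<in> pverts G. \<exists>p. pre_digraph.awalk (with_proj G) u p v \<and> length p \<le> k)"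
proof -
  interpret pair_wf_digraph G by fact
  have wf: "wf_digraph (with_proj G)" by unfold_locales
  have cost: "awalk_cost (\<lambda>_. 1) p = real (length p)" for p :: "('a \<times> 'a) list"
    by (induction p) auto
  have "wf_digraph.\<mu> (with_proj G) (\<lambda>_. 1) u v \<le> ereal (real k) \<longleftrightarrow>
      (\<exists>p. pre_digraph.awalk (with_proj G) u p v \<and> length p \<le> k)" for u v
  proof
    assume "wf_digraph.\<mu> (with_proj G) (\<lambda>_. 1) u v \<le> ereal (real k)"
    also have "\<dots> < ereal (real (Suc k))" by simp
    finally obtain p where "pre_digraph.awalk (with_proj G) u p v"
      "ereal (real (length p)) < ereal (real (Suc k))"
      unfolding wf_digraph.\<mu>_def[OF wf] INF_less_iff cost by blast
    then show "\<exists>p. pre_digraph.awalk (with_proj G) u p v \<and> length p \<le> k" by auto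
  next
    assume "\<exists>p. pre_digraph.awalk (with_proj G) u p v \<and> length p \<le> k"
    then obtain p where p: "pre_digraph.awalk (with_proj G) u p v" "length p \<le> k" by blast
    then show "wf_digraph.\<mu> (with_proj G) (\<lambda>_. 1) u v \<le> ereal (real k)"
      unfolding wf_digraph.\<mu>_def[OF wf] cost by (auto intro!: INF_lower2[of p])
  qed
  then show ?thesis unfolding diameter_def SUP_le_iff by simp
qed

end

theory Submission
  imports Defs
begin

text \<open>
  If \<open>G\<close> is not bipartite, it contains a five-cycle and hence equals it; then \<open>l \<ge> 4\<close> exceeds the
  maximum degree by two, and vertices can be given their final colours one by one. If \<open>G\<close> is
  bipartite with an edge, a colouring in which every colour occurs on both sides forces \<open>G\<close> to be
  \<open>K\<^bsub>l,l\<^esub>\<close> minus a perfect matching. Otherwise some colour is missing on one side, so the other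
  side can be made monochromatic, and three colours suffice to shuffle the sides into place. This
  gives the bound \<open>3n\<close>.
\<close>

section \<open>Isomorphisms and forbidden induced subgraphs\<close>

text \<open>Library isomorphisms also carry a map on arcs. Arcs here are ordered pairs, so the
  vertex bijection \<open>f\<close> determines that map as \<open>map_prod f f\<close>.\<close>

lemma graph_isoI:
  assumes "pair_wf_digraph G" "pair_wf_digraph H"
    and bij: "bij_betw f (pverts G) (pverts H)"
    and arcs: "\<And>u v. u \<in> pverts G \<Longrightarrow> v \<in> pverts G \<Longrightarrow> (f u, f v) \<in> parcs H \<longleftrightarrow> (u, v) \<in> parcs G"
  shows "graph_iso G H"
proof -
  interpret G: pair_wf_digraph G by fact
  interpret H: pair_wf_digraph H by fact
  have inj: "inj_on f (pverts G)" and img: "f ` pverts G = pverts H"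
    using bij by (auto simp: bij_betw_def)
  let ?h = "\<lparr>iso_verts = f, iso_arcs = map_prod f f, iso_head = snd, iso_tail = fst\<rparr>"
  have "inj_on (map_prod f f) (pverts G \<times> pverts G)"
    using inj by (rule map_prod_inj_on[OF _ inj])
  then have "inj_on (map_prod f f) (parcs G)"
    by (rule inj_on_subset) (auto dest: G.wellformed')
  then have hom: "pre_digraph.digraph_isomorphism (with_proj G) ?h"
    using inj G.wf_digraph_axioms by (auto simp: pre_digraph.digraph_isomorphism_def)
  have "map_prod f f ` parcs G = parcs H"
  proof
    show "map_prod f f ` parcs G \<subseteq> parcs H"
      using arcs by (auto dest: G.wellformed')
    show "parcs H \<subseteq> map_prod f f ` parcs G"
    proof
      fix e assume e: "e \<in> parcs H"
      then obtain u v where "e = (f u, f v)" "u \<in> pverts G" "v \<in> pverts G"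
        using img by (metis H.arc_fst_in_verts H.arc_snd_in_verts imageE prod.collapse)
      then show "e \<in> map_prod f f ` parcs G"
        using e arcs by force
    qed
  qed
  then have "with_proj H = app_iso ?h (with_proj G)"
    using img by (simp add: app_iso_def with_proj_def)
  with hom show ?thesis
    unfolding graph_iso_def digraph_iso_def by blast
qed

text \<open>Lets a forbidden subgraph be refuted by an explicit embedding \<open>f\<close>: the
  subgraph induced on the image of \<open>f\<close> is a copy of \<open>H\<close>, with the inverse
  of \<open>f\<close> as isomorphism.\<close>

lemma induced_freeD:
  assumes free: "induced_free H G" and G: "pair_wf_digraph G" and H: "pair_wf_digraph H"
    and inj: "inj_on f (pverts H)" and sub: "f ` pverts H \<subseteq> pverts G"
    and arcs: "\<And>u v. u \<in> pverts H \<Longrightarrow> v \<in> pverts H \<Longrightarrow> (f u, f v) \<in> parcs G \<longleftrightarrow> (u, v) \<in> parcs H"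
  shows False
proof -
  interpret G: pair_wf_digraph G by fact
  let ?V = "f ` pverts H"
  let ?H' = "\<lparr>pverts = ?V, parcs = parcs G \<inter> ?V \<times> ?V\<rparr>"
  have H': "pair_wf_digraph ?H'"
    by unfold_locales auto
  have "induced_subgraph (with_proj ?H') (with_proj G)"
    using sub H' G.wf_digraph_axioms
    by (auto simp: induced_subgraph_def subgraph_def wf_digraph_wp_iff)
  moreover have "graph_iso ?H' H"
    using H' H
  proof (rule graph_isoI)
    show "bij_betw (the_inv_into (pverts H) f) (pverts ?H') (pverts H)"
      using bij_betw_the_inv_into[OF inj_on_imp_bij_betw[OF inj]] by simp
  qed (auto simp: the_inv_into_f_f[OF inj] arcs)
  ultimately show False
    using free unfolding induced_free_def by blast
qed

lemma pair_wf_triangle_graph: "pair_wf_digraph triangle_graph"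
  by unfold_locales (auto simp: triangle_graph_def complete_graph_def)

lemma pair_wf_co_diamond: "pair_wf_digraph co_diamond"
  by unfold_locales (auto simp: co_diamond_eq)

section \<open>Adjacency, independent sets and bipartitions\<close>

context pair_graph
begin

abbreviation adj :: "'a \<Rightarrow> 'a \<Rightarrow> bool" (infix "\<sim>" 50) where
  "u \<sim> v \<equiv> (u, v) \<in> parcs G"

definition independent :: "'a set \<Rightarrow> bool" where
  "independent S \<longleftrightarrow> S \<subseteq> pverts G \<and> (\<forall>u \<in> S. \<forall>v \<in> S. \<not> u \<sim> v)"

definition bipartition :: "'a set \<Rightarrow> 'a set \<Rightarrow> bool" where
  "bipartition A B \<longleftrightarrow> independent A \<and> independent B \<and> A \<union> B = pverts G \<and> A \<inter> B = {}"

lemma adj_sym: "u \<sim> v \<Longrightarrow> v \<sim> u"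
  using pair_sym_arcs by (auto simp: symmetric_def dest: symD)

lemma adj_irrefl: "\<not> u \<sim> u"
  using pair_no_loops by force

lemma bipartition_sym: "bipartition A B \<Longrightarrow> bipartition B A"
  by (auto simp: bipartition_def)

section \<open>Distances between colourings\<close>

text \<open>This has the form of the right-hand side of \<open>diameter_le_iff\<close>, so a
  diameter bound \<open>k\<close> means \<open>reach l k c d\<close> for all colourings
  \<open>c\<close> and \<open>d\<close>.\<close>

definition reach :: "nat \<Rightarrow> nat \<Rightarrow> ('a \<Rightarrow> nat) \<Rightarrow> ('a \<Rightarrow> nat) \<Rightarrow> bool" where
  "reach l k c d \<longleftrightarrow>
     (\<exists>p. pre_digraph.awalk (with_proj (recolouring_graph l G)) c p d \<and> length p \<le> k)"

lemma reach_trans: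
  assumes "reach l m c d" "reach l n d e"
  shows "reach l (m + n) c e"
proof -
  interpret R: pair_graph "recolouring_graph l G"
    by (rule pair_graph_recolouring_graph) (rule pair_graph_axioms)
  obtain p q where "R.awalk c p d" "length p \<le> m" "R.awalk d q e" "length q \<le> n"
    using assms unfolding reach_def by blast
  then have "R.awalk c (p @ q) e \<and> length (p @ q) \<le> m + n"
    by (auto intro: R.awalk_appendI)
  then show ?thesis
    unfolding reach_def by blast
qed

lemma reach_mono: "reach l m c d \<Longrightarrow> m \<le> n \<Longrightarrow> reach l n c d"
  unfolding reach_def using le_trans by blast

lemma reach_refl:
  assumes "c \<in> colourings l G"
  shows "reach l k c c"
proof -
  interpret R: pair_graph "recolouring_graph l G"
    by (rule pair_graph_recolouring_graph) (rule pair_graph_axioms)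
  have "R.awalk c [] c"
    using assms by (simp add: R.awalk_Nil_iff) (simp add: recolouring_graph_def)
  then show ?thesis
    unfolding reach_def by force
qed

lemma colouringsI:
  assumes "c \<in> extensional (pverts G)" "\<And>v. v \<in> pverts G \<Longrightarrow> c v \<in> {1..l}"
    and "\<And>u v. u \<sim> v \<Longrightarrow> c u \<noteq> c v"
  shows "c \<in> colourings l G"
  using assms by (auto simp: colourings_def PiE_def)

lemma
  assumes "c \<in> colourings l G"
  shows colouring_extensional: "c \<in> extensional (pverts G)"
    and colouring_range: "v \<in> pverts G \<Longrightarrow> c v \<in> {1..l}"
    and colouring_proper: "u \<sim> v \<Longrightarrow> c u \<noteq> c v"
  using assms by (auto simp: colourings_def PiE_def)

lemma reach_update:
  assumes "c \<in> colourings l G" "c(v := k) \<in> colourings l G" "v \<in> pverts G"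
  shows "reach l 1 c (c(v := k))"
proof (cases "c v = k")
  case True
  then have "c(v := k) = c" by auto
  then show ?thesis using reach_refl[OF assms(1)] by simp
next
  case False
  interpret R: pair_graph "recolouring_graph l G"
    by (rule pair_graph_recolouring_graph) (rule pair_graph_axioms)
  have "(c, c(v := k)) \<in> parcs (recolouring_graph l G)"
    using assms False by (auto simp: recolouring_graph_def)
  then have "R.awalk c [(c, c(v := k))] (c(v := k))"
    using assms by (simp add: R.awalk_simps) (simp add: recolouring_graph_def)
  then show ?thesis
    unfolding reach_def by force
qed

text \<open>Vertices of an independent set can be recoloured one after the other in any order, because
  all their neighbours already have their final colours.\<close>

lemma reach_independent:
  assumes "independent A" "c \<in> colourings l G" "d \<in> colourings l G"
    and "\<And>v. v \<notin> A \<Longrightarrow> c v = d v"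
  shows "reach l (card A) c d"
proof -
  have "finite A"
    using assms(1) finite_subset[OF _ pair_finite_verts] by (simp add: independent_def)
  then show ?thesis
    using assms
  proof (induction A arbitrary: c)
    case empty
    then have "c = d" by auto
    then show ?case using empty reach_refl by simp
  next
    case (insert a A)
    let ?c = "c(a := d a)"
    have a: "a \<in> pverts G" using insert.prems(1) by (auto simp: independent_def)
    have nbr: "c w = d w" if "a \<sim> w \<or> w \<sim> a" for w
      using that insert.prems(1) by (intro insert.prems(4)) (auto simp: independent_def)
    have c': "?c \<in> colourings l G"
    proof (rule colouringsI)
      show "?c \<in> extensional (pverts G)"
        using colouring_extensional[OF insert.prems(2)] a by (auto simp: extensional_def)
      show "?c v \<in> {1..l}" if "v \<in> pverts G" for v
        using that colouring_range insert.prems(2,3) by auto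
      show "?c u \<noteq> ?c v" if "u \<sim> v" for u v
        using that nbr colouring_proper[OF insert.prems(2) that]
          colouring_proper[OF insert.prems(3) that] by (auto split: if_splits)
    qed
    have "reach l (card A) ?c d"
      using insert.prems(1,4)
      by (intro insert.IH[OF _ c' insert.prems(3)]) (auto simp: independent_def)
    then have "reach l (1 + card A) c d"
      using reach_update[OF insert.prems(2) c' a] reach_trans by blast
    then show ?case using insert.hyps by simp
  qed
qed

section \<open>Graphs of small maximum degree\<close>

text \<open>To give \<open>v\<close> its final colour, first move its neighbours away from that colour; these
  neighbours form a colour class and none of them has its final colour yet.\<close>

lemma reach_fix_vertex:
  assumes deg: "\<And>v. card {w. v \<sim> w} \<le> D" and l: "D + 2 \<le> l"
    and c: "c \<in> colourings l G" and d: "d \<in> colourings l G" and v: "v \<in> pverts G"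
    and S: "\<And>u. u \<in> S \<Longrightarrow> c u = d u"
  obtains c' where "c' \<in> colourings l G" "\<And>u. u \<in> insert v S \<Longrightarrow> c' u = d u" "reach l (D + 1) c c'"
proof -
  define k where "k = d v"
  define T where "T = {u. v \<sim> u \<and> c u = k}"
  have fin: "finite {w. u \<sim> w}" for u
    by (rule finite_subset[OF _ pair_finite_verts]) (auto dest: wellformed')
  \<comment> \<open>The colour \<open>k\<close> and the colours on at most \<open>D\<close>
    neighbours exclude at most \<open>D + 1\<close> colours, fewer than \<open>l\<close>.\<close>
  have "\<exists>x. x \<in> {1..l} \<and> x \<notin> insert k (c ` {w. u \<sim> w})" for u
  proof -
    have "card (insert k (c ` {w. u \<sim> w})) \<le> Suc (card (c ` {w. u \<sim> w}))"
      by (rule card_insert_le_m1) simp_all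
    also have "\<dots> \<le> Suc D"
      using card_image_le[OF fin[of u], of c] deg[of u] by simp
    finally have "card (insert k (c ` {w. u \<sim> w})) < card {1..l}"
      using l by simp
    then show ?thesis
      using card_mono[of "insert k (c ` {w. u \<sim> w})" "{1..l}"] fin[of u]
      by (metis finite_imageI finite_insert not_less subsetI)
  qed
  then obtain g where g: "\<And>u. g u \<in> {1..l} \<and> g u \<notin> insert k (c ` {w. u \<sim> w})"
    by metis
  have T: "independent T"
    using colouring_proper[OF c] by (fastforce simp: independent_def T_def dest: wellformed')
  \<comment> \<open>All of \<open>T\<close> may move to the colours \<open>g\<close> at once:
    \<open>T\<close> is independent, and \<open>g u\<close> avoids the colours of all neighbours of
    \<open>u\<close>.\<close>
  define c1 where "c1 = (\<lambda>u. if u \<in> T then g u else c u)"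
  have c1: "c1 \<in> colourings l G"
  proof (rule colouringsI)
    show "c1 \<in> extensional (pverts G)"
      using T colouring_extensional[OF c] by (auto simp: extensional_def c1_def independent_def)
    show "c1 u \<in> {1..l}" if "u \<in> pverts G" for u
      using that g colouring_range[OF c] by (auto simp: c1_def)
    show "c1 u \<noteq> c1 w" if "u \<sim> w" for u w
    proof -
      have "\<not> (u \<in> T \<and> w \<in> T)" using T that by (auto simp: independent_def)
      moreover have "g u \<noteq> c w" using g[of u] that by blast
      moreover have "g w \<noteq> c u" using g[of w] adj_sym[OF that] by blast
      ultimately show ?thesis
        using colouring_proper[OF c that] by (auto simp: c1_def)
    qed
  qed
  have "card T \<le> D"
    using order_trans[OF card_mono[OF fin[of v], of T] deg[of v]] by (auto simp: T_def)
  moreover have "reach l (card T) c c1"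
    using T c c1 by (rule reach_independent) (simp add: c1_def)
  ultimately have 1: "reach l D c c1"
    using reach_mono by blast
  have avoid: "c1 u \<noteq> k" if "v \<sim> u" for u
    using that g[of u] by (auto simp: c1_def T_def)
  let ?c = "c1(v := k)"
  have c2: "?c \<in> colourings l G"
  proof (rule colouringsI)
    show "?c \<in> extensional (pverts G)"
      using colouring_extensional[OF c1] v by (auto simp: extensional_def)
    show "?c u \<in> {1..l}" if "u \<in> pverts G" for u
      using that colouring_range[OF c1] colouring_range[OF d v] by (auto simp: k_def)
    show "?c u \<noteq> ?c w" if "u \<sim> w" for u w
      using that adj_sym[OF that] avoid colouring_proper[OF c1 that] adj_irrefl by auto
  qed
  have "reach l (D + 1) c ?c"
    using reach_trans[OF 1 reach_update[OF c1 c2 v]] .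
  \<comment> \<open>Finished vertices stay finished: a vertex of both \<open>S\<close> and
    \<open>T\<close> would be a neighbour of \<open>v\<close> with \<open>d\<close>-colour
    \<open>d v\<close>, contradicting that \<open>d\<close> is proper.\<close>
  moreover have "?c u = d u" if "u \<in> insert v S" for u
    using that S colouring_proper[OF d, of v u] by (auto simp: c1_def T_def k_def)
  ultimately show ?thesis
    using that c2 by blast
qed

text \<open>Vertices are finished one at a time by \<open>reach_fix_vertex\<close>, each at a cost
  of at most \<open>D + 1\<close> moves and without spoiling earlier ones.\<close>

lemma reach_max_degree:
  assumes deg: "\<And>v. card {w. v \<sim> w} \<le> D" and l: "D + 2 \<le> l"
    and c: "c \<in> colourings l G" and d: "d \<in> colourings l G"
  shows "reach l ((D + 1) * card (pverts G)) c d"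
proof -
  have "\<exists>c'. c' \<in> colourings l G \<and> (\<forall>u \<in> S. c' u = d u) \<and> reach l ((D + 1) * card S) c c'"
    if "finite S" "S \<subseteq> pverts G" for S
    using that
  proof (induction S)
    case empty
    then show ?case using c reach_refl by force
  next
    case (insert v S)
    then obtain c' where c': "c' \<in> colourings l G" "\<And>u. u \<in> S \<Longrightarrow> c' u = d u"
      "reach l ((D + 1) * card S) c c'" by blast
    obtain c'' where c'': "c'' \<in> colourings l G" "\<And>u. u \<in> insert v S \<Longrightarrow> c'' u = d u"
      "reach l (D + 1) c' c''"
      using reach_fix_vertex[OF deg l c'(1) d _ c'(2), of v] insert.prems by auto
    have "reach l ((D + 1) * card (insert v S)) c c''"
      using reach_trans[OF c'(3) c''(3)] insert.hyps by (simp add: algebra_simps)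
    then show ?case using c''(1,2) by blast
  qed
  then obtain c' where c': "c' \<in> colourings l G" "\<forall>u \<in> pverts G. c' u = d u"
    "reach l ((D + 1) * card (pverts G)) c c'"
    using pair_finite_verts by blast
  have "c' = d"
    by (rule extensionalityI[OF colouring_extensional[OF c'(1)] colouring_extensional[OF d]])
      (use c'(2) in auto)
  with c'(3) show ?thesis by simp
qed

section \<open>Bipartite graphs\<close>

text \<open>Restricting to \<open>pverts G\<close> yields an extensional function for arbitrary
  \<open>f\<close> and \<open>g\<close>, so constant functions can describe monochromatic
  sides.\<close>

definition mix :: "'a set \<Rightarrow> ('a \<Rightarrow> nat) \<Rightarrow> ('a \<Rightarrow> nat) \<Rightarrow> 'a \<Rightarrow> nat" where
  "mix A f g = (\<lambda>v \<in> pverts G. if v \<in> A then f v else g v)"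

lemma mix_colouring:
  assumes "bipartition A B"
    and "\<And>v. v \<in> A \<Longrightarrow> f v \<in> {1..l}" "\<And>v. v \<in> B \<Longrightarrow> g v \<in> {1..l}"
    and "\<And>u v. u \<in> A \<Longrightarrow> v \<in> B \<Longrightarrow> u \<sim> v \<Longrightarrow> f u \<noteq> g v"
  shows "mix A f g \<in> colourings l G"
proof (rule colouringsI)
  show "mix A f g \<in> extensional (pverts G)" by (simp add: mix_def)
  show "mix A f g v \<in> {1..l}" if "v \<in> pverts G" for v
    using that assms(1-3) by (auto simp: mix_def bipartition_def)
  show "mix A f g u \<noteq> mix A f g v" if "u \<sim> v" for u v
  proof -
    have uv: "u \<in> pverts G" "v \<in> pverts G" "v \<sim> u"
      using that adj_sym by (auto dest: wellformed')
    consider "u \<in> A" "v \<in> B" | "u \<in> B" "v \<in> A"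
      using that uv assms(1) unfolding bipartition_def independent_def by blast
    then show ?thesis
    proof cases
      case 1
      then have "v \<notin> A" using assms(1) by (auto simp: bipartition_def)
      then show ?thesis using 1 uv that assms(4)[of u v] by (simp add: mix_def)
    next
      case 2
      then have "u \<notin> A" using assms(1) by (auto simp: bipartition_def)
      then show ?thesis using 2 uv assms(4)[of v u] by (simp add: mix_def)
    qed
  qed
qed

lemma mix_self: "c \<in> colourings l G \<Longrightarrow> mix A c c = c"
  using colouring_extensional[of c l] by (auto simp: mix_def fun_eq_iff extensional_def)

lemma reach_mix_left:
  assumes "bipartition A B" "mix A f g \<in> colourings l G" "mix A f' g \<in> colourings l G"
  shows "reach l (card A) (mix A f g) (mix A f' g)"
  using assms by (intro reach_independent) (auto simp: bipartition_def mix_def)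

lemma reach_mix_right:
  assumes "bipartition A B" "mix A f g \<in> colourings l G" "mix A f g' \<in> colourings l G"
  shows "reach l (card B) (mix A f g) (mix A f g')"
  using assms by (intro reach_independent) (auto simp: bipartition_def mix_def)

text \<open>Since \<open>i\<close> is missing on \<open>B\<close>, side \<open>A\<close> can become
  constantly \<open>i\<close>, and then \<open>B\<close> constantly \<open>e\<close>. From two
  monochromatic sides, the target is approached by running the same idea backwards with the colour
  \<open>j\<close>, which may be missing on either side. Each side is recoloured at most three
  times.\<close>

lemma reach_bipartite:
  assumes bip: "bipartition A B" and l: "3 \<le> l"
    and c: "c \<in> colourings l G" and d: "d \<in> colourings l G"
    and i: "i \<in> {1..l}" "i \<notin> c ` B" and j: "j \<in> {1..l}" "j \<notin> d ` A \<or> j \<notin> d ` B"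
  shows "reach l (3 * card (pverts G)) c d"
proof -
  have AB: "A \<subseteq> pverts G" "B \<subseteq> pverts G"
    using bip by (auto simp: bipartition_def)
  have card: "card A + card B = card (pverts G)"
    using bip pair_finite_verts card_Un_disjoint[of A B] finite_subset[OF AB(1)] finite_subset[OF AB(2)]
    by (auto simp: bipartition_def)
  have pick: "\<exists>e. e \<in> {1..l} \<and> e \<noteq> x \<and> e \<noteq> y" for x y :: nat
  proof -
    have "\<not> {1..3} \<subseteq> {x, y}"
      using card_mono[of "{x, y}" "{1..3::nat}"] card_insert_le_m1[of 2 "{y}" x] by auto
    then show ?thesis using l by fastforce
  qed
  \<comment> \<open>The colour of \<open>B\<close> must be compatible with \<open>A\<close> being
    constantly \<open>i\<close> and also constantly \<open>j\<close>; three colours leave room for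
    this.\<close>
  obtain e where e: "e \<in> {1..l}" "e \<noteq> i" "e \<noteq> j" using pick by blast
  let ?k = "\<lambda>(x::nat) _. x"
  have cr: "\<And>v. v \<in> pverts G \<Longrightarrow> c v \<in> {1..l}" and dr: "\<And>v. v \<in> pverts G \<Longrightarrow> d v \<in> {1..l}"
    using colouring_range c d by auto
  have c0: "mix A c c \<in> colourings l G" and d0: "mix A d d \<in> colourings l G"
    using c d mix_self by simp_all
  have c1: "mix A (?k i) c \<in> colourings l G"
    using bip AB i cr by (intro mix_colouring[OF bip]) auto
  have c2: "mix A (?k i) (?k e) \<in> colourings l G"
    using bip AB i e by (intro mix_colouring[OF bip]) auto
  have start: "reach l (card A + card B) c (mix A (?k i) (?k e))"
    using reach_trans[OF reach_mix_left[OF bip c0 c1] reach_mix_right[OF bip c1 c2]]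
    by (simp add: mix_self[OF c])
  from j(2) show ?thesis
  proof
    assume j: "j \<notin> d ` B"
    have c3: "mix A (?k j) (?k e) \<in> colourings l G"
      using bip AB \<open>j \<in> {1..l}\<close> e by (intro mix_colouring[OF bip]) auto
    have c4: "mix A (?k j) d \<in> colourings l G"
      using bip AB \<open>j \<in> {1..l}\<close> j dr by (intro mix_colouring[OF bip]) auto
    have "reach l (card A + card B + card A + card B + card A) c d"
      using reach_trans[OF reach_trans[OF reach_trans[OF start reach_mix_left[OF bip c2 c3]]
          reach_mix_right[OF bip c3 c4]] reach_mix_left[OF bip c4 d0]]
      by (simp add: mix_self[OF d])
    then show ?thesis
      by (rule reach_mono) (use card in auto)
  next
    assume j: "j \<notin> d ` A"
    \<comment> \<open>\<open>B\<close> has to change from \<open>e\<close> to \<open>j\<close>, but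
      \<open>A\<close> may already use \<open>j\<close> when \<open>i = j\<close>. So
      \<open>A\<close> is first parked on a colour \<open>f\<close> different from both.\<close>
    obtain f where f: "f \<in> {1..l}" "f \<noteq> e" "f \<noteq> j" using pick by blast
    have c3: "mix A (?k f) (?k e) \<in> colourings l G"
      using bip AB f e by (intro mix_colouring[OF bip]) auto
    have c4: "mix A (?k f) (?k j) \<in> colourings l G"
      using bip AB \<open>j \<in> {1..l}\<close> f by (intro mix_colouring[OF bip]) auto
    have c5: "mix A d (?k j) \<in> colourings l G"
      using bip AB \<open>j \<in> {1..l}\<close> j dr by (intro mix_colouring[OF bip]) auto
    have "reach l (card A + card B + card A + card B + card A + card B) c d"
      using reach_trans[OF reach_trans[OF reach_trans[OF reach_trans[OF start
          reach_mix_left[OF bip c2 c3]] reach_mix_right[OF bip c3 c4]]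
          reach_mix_left[OF bip c4 c5]] reach_mix_right[OF bip c5 d0]]
      by (simp add: mix_self[OF d])
    then show ?thesis
      by (rule reach_mono) (use card in auto)
  qed
qed

section \<open>Two-colourability and the chromatic number\<close>

lemma bipartition_colouring:
  assumes "bipartition A B"
  shows "colourings 2 G \<noteq> {}"
  using mix_colouring[OF assms, of "\<lambda>_. 1" 2 "\<lambda>_. 2"] by auto

lemma colouring_bipartition:
  assumes "colourings 2 G \<noteq> {}"
  obtains A B where "bipartition A B"
proof -
  obtain c where c: "c \<in> colourings 2 G" using assms by blast
  have "c v = 1 \<or> c v = 2" if "v \<in> pverts G" for v
    using colouring_range[OF c that] by auto
  then have "bipartition {v \<in> pverts G. c v = 1} {v \<in> pverts G. c v = 2}"
    using colouring_proper[OF c] by (fastforce simp: bipartition_def independent_def)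
  then show ?thesis by (rule that)
qed

lemma colourings_mono:
  assumes "k \<le> l"
  shows "colourings k G \<subseteq> colourings l G"
proof
  fix c assume c: "c \<in> colourings k G"
  show "c \<in> colourings l G"
    using colouring_extensional[OF c] colouring_range[OF c] colouring_proper[OF c] assms
    by (intro colouringsI) force+
qed

text \<open>Shows that the \<open>LEAST\<close> in the definition is attained: a bijection onto
  \<open>{1..card (pverts G)}\<close> is always a proper colouring.\<close>

lemma chromatic_number_colourable: "colourings (chromatic_number G) G \<noteq> {}"
proof -
  obtain h where h: "bij_betw h (pverts G) {1..card (pverts G)}"
    using finite_same_card_bij[OF pair_finite_verts, of "{1..card (pverts G)}"] by auto
  have "restrict h (pverts G) \<in> colourings (card (pverts G)) G"
    using h adj_irrefl
    by (intro colouringsI) (auto simp: bij_betw_def inj_on_def dest: wellformed')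
  then have "\<exists>k. colourings k G \<noteq> {}" by blast
  then show ?thesis
    unfolding chromatic_number_def by (rule LeastI_ex)
qed

end

section \<open>Triangle- and co-diamond-free graphs\<close>

locale triangle_co_diamond_free = pair_graph +
  assumes triangle_free: "induced_free triangle_graph G"
    and co_diamond_free: "induced_free co_diamond G"
begin

lemma no_triangle:
  assumes "u \<sim> v" "v \<sim> w" "w \<sim> u"
  shows False
proof (rule induced_freeD[OF triangle_free _ pair_wf_triangle_graph])
  show "pair_wf_digraph G" by unfold_locales
  have ne: "u \<noteq> v" "v \<noteq> w" "w \<noteq> u"
    using assms adj_irrefl by auto
  have V: "pverts triangle_graph = {0, 1, 2}"
    by (auto simp: triangle_graph_def complete_graph_def)
  let ?f = "\<lambda>i. [u, v, w] ! i"
  show "inj_on ?f (pverts triangle_graph)"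
    using ne by (auto simp: V inj_on_def)
  show "?f ` pverts triangle_graph \<subseteq> pverts G"
    using assms by (auto simp: V dest: wellformed')
  show "(?f i, ?f j) \<in> parcs G \<longleftrightarrow> (i, j) \<in> parcs triangle_graph"
    if "i \<in> pverts triangle_graph" "j \<in> pverts triangle_graph" for i j
    using that assms[THEN adj_sym] assms adj_irrefl unfolding V
    by (auto simp: triangle_graph_def complete_graph_def)
qed

lemma no_co_diamond:
  assumes "u \<sim> v" "x \<in> pverts G" "y \<in> pverts G" "x \<noteq> y"
    and "\<not> x \<sim> u" "\<not> x \<sim> v" "\<not> y \<sim> u" "\<not> y \<sim> v"
  shows "x \<sim> y"
proof (rule ccontr)
  assume xy: "\<not> x \<sim> y"
  have vu: "v \<sim> u" using assms(1) by (rule adj_sym)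
  \<comment> \<open>\<open>x\<close> and \<open>y\<close> cannot be ends of the edge, as each end is
    adjacent to the other.\<close>
  have ne: "u \<noteq> v" "x \<noteq> u" "x \<noteq> v" "y \<noteq> u" "y \<noteq> v"
    using assms vu adj_irrefl by auto
  have na: "\<not> u \<sim> x" "\<not> v \<sim> x" "\<not> u \<sim> y" "\<not> v \<sim> y" "\<not> y \<sim> x"
    using assms xy adj_sym by blast+
  let ?f = "\<lambda>i. [u, v, x, y] ! i"
  show False
  proof (rule induced_freeD[OF co_diamond_free _ pair_wf_co_diamond])
    show "pair_wf_digraph G" by unfold_locales
    show "inj_on ?f (pverts co_diamond)"
      using ne assms(4) by (auto simp: co_diamond_eq inj_on_def)
    show "?f ` pverts co_diamond \<subseteq> pverts G"
      using assms by (auto simp: co_diamond_eq dest: wellformed')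
    show "(?f i, ?f j) \<in> parcs G \<longleftrightarrow> (i, j) \<in> parcs co_diamond"
      if "i \<in> pverts co_diamond" "j \<in> pverts co_diamond" for i j
      using that assms vu xy na adj_irrefl by (auto simp: co_diamond_eq)
  qed
qed

text \<open>By triangle-freeness a closed walk of length five is an induced five-cycle. Each edge of the
  cycle allows at most two adjacent non-neighbours, so there is no vertex off the cycle.\<close>

lemma five_cycle_degree:
  assumes C: "a \<sim> b" "b \<sim> c" "c \<sim> d" "d \<sim> e" "e \<sim> a"
  shows "card {w. v \<sim> w} \<le> 2"
proof -
  note C' = C[THEN adj_sym]
  have na: "\<not> a \<sim> c" "\<not> a \<sim> d" "\<not> b \<sim> d" "\<not> b \<sim> e" "\<not> c \<sim> e"
    "\<not> c \<sim> a" "\<not> d \<sim> a" "\<not> d \<sim> b" "\<not> e \<sim> b" "\<not> e \<sim> c"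
    using C C' no_triangle by blast+
  have V: "a \<in> pverts G" "b \<in> pverts G" "c \<in> pverts G" "d \<in> pverts G" "e \<in> pverts G"
    using C by (auto dest: wellformed')
  have all: "w \<in> {a, b, c, d, e}" if w: "w \<in> pverts G" for w
  proof (rule ccontr)
    assume "w \<notin> {a, b, c, d, e}"
    then have ne: "w \<noteq> a" "w \<noteq> b" "w \<noteq> c" "w \<noteq> d" "w \<noteq> e" by auto
    \<comment> \<open>Each cycle edge is paired with the cycle vertex opposite to it, so
      \<open>w\<close> has a neighbour in each of these five triples. Being adjacent to no two
      consecutive vertices, \<open>w\<close> has at most two neighbours on the cycle, and these
      always miss some triple.\<close>
    have "w \<sim> a \<or> w \<sim> b \<or> w \<sim> d" using no_co_diamond[OF C(1) w V(4)] ne na by blast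
    moreover have "w \<sim> b \<or> w \<sim> c \<or> w \<sim> e" using no_co_diamond[OF C(2) w V(5)] ne na by blast
    moreover have "w \<sim> c \<or> w \<sim> d \<or> w \<sim> a" using no_co_diamond[OF C(3) w V(1)] ne na by blast
    moreover have "w \<sim> d \<or> w \<sim> e \<or> w \<sim> b" using no_co_diamond[OF C(4) w V(2)] ne na by blast
    moreover have "w \<sim> e \<or> w \<sim> a \<or> w \<sim> c" using no_co_diamond[OF C(5) w V(3)] ne na by blast
    moreover have "\<not> (w \<sim> a \<and> w \<sim> b)" "\<not> (w \<sim> b \<and> w \<sim> c)" "\<not> (w \<sim> c \<and> w \<sim> d)"
      "\<not> (w \<sim> d \<and> w \<sim> e)" "\<not> (w \<sim> e \<and> w \<sim> a)"
      using C no_triangle adj_sym by blast+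
    ultimately show False by blast
  qed
  have two: "card {w. v \<sim> w} \<le> 2" if "{w. v \<sim> w} \<subseteq> {x, y}" for x y
    using card_mono[OF _ that] card_insert_le_m1[of 2 "{y}" x] by auto
  have N: "{w. v \<sim> w} \<subseteq> {a, b, c, d, e}"
    using all by (auto dest: wellformed')
  \<comment> \<open>The bound is needed for arbitrary \<open>v\<close>; outside the graph the
    neighbourhood is empty.\<close>
  consider "v = a" | "v = b" | "v = c" | "v = d" | "v = e" | "v \<notin> pverts G"
    using all by auto
  then show ?thesis
  proof cases
    case 1 show ?thesis by (rule two[of b e]) (use N 1 na adj_irrefl in auto)
  next
    case 2 show ?thesis by (rule two[of a c]) (use N 2 na adj_irrefl in auto)
  next
    case 3 show ?thesis by (rule two[of b d]) (use N 3 na adj_irrefl in auto)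
  next
    case 4 show ?thesis by (rule two[of c e]) (use N 4 na adj_irrefl in auto)
  next
    case 5 show ?thesis by (rule two[of d a]) (use N 5 na adj_irrefl in auto)
  next
    case 6
    then have "{w. v \<sim> w} = {}" by (auto dest: wellformed')
    then show ?thesis by simp
  qed
qed

text \<open>Fix an edge \<open>uv\<close>. The neighbourhoods \<open>P\<close> of \<open>u\<close>
  and \<open>Q\<close> of \<open>v\<close> are disjoint and independent by triangle-freeness. The
  remaining set \<open>S\<close> is a clique by co-diamond-freeness, so it has at most two vertices.
  Without a closed walk of length five, these can be distributed over the two sides.\<close>

lemma bipartite_or_five_cycle:
  obtains A B where "bipartition A B"
  | a b c d e where "a \<sim> b" "b \<sim> c" "c \<sim> d" "d \<sim> e" "e \<sim> a"
proof (cases "parcs G = {}")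
  case True
  then have "bipartition (pverts G) {}"
    by (auto simp: bipartition_def independent_def)
  then show ?thesis by (rule that(1))
next
  case False
  then obtain u v where uv: "u \<sim> v" by auto
  show ?thesis
  proof (cases "\<exists>a b c d e. a \<sim> b \<and> b \<sim> c \<and> c \<sim> d \<and> d \<sim> e \<and> e \<sim> a")
    case True
    then show ?thesis using that(2) by blast
  next
    case False
    then have no5: "\<not> (a \<sim> b \<and> b \<sim> c \<and> c \<sim> d \<and> d \<sim> e \<and> e \<sim> a)" for a b c d e
      by blast
    define P where "P = {w. u \<sim> w}"
    define Q where "Q = {w. v \<sim> w}"
    define S where "S = pverts G - P - Q"
    define hasP where "hasP x \<longleftrightarrow> (\<exists>w \<in> P. x \<sim> w)" for x
    define hasQ where "hasQ x \<longleftrightarrow> (\<exists>w \<in> Q. x \<sim> w)" for x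
    have sub: "P \<subseteq> pverts G" "Q \<subseteq> pverts G" "P \<inter> Q = {}"
      unfolding P_def Q_def using no_triangle uv adj_sym by (auto dest: wellformed') blast
    have indP: "\<not> x \<sim> y" if "x \<in> P" "y \<in> P" for x y
      using that no_triangle adj_sym unfolding P_def by blast
    have indQ: "\<not> x \<sim> y" if "x \<in> Q" "y \<in> Q" for x y
      using that no_triangle adj_sym unfolding Q_def by blast
    have clique: "x \<sim> y" if "x \<in> S" "y \<in> S" "x \<noteq> y" for x y
      using that no_co_diamond[OF uv, of x y] adj_sym unfolding S_def P_def Q_def by blast
    \<comment> \<open>Neighbours \<open>p\<close> in \<open>P\<close> and \<open>q\<close> in
      \<open>Q\<close> of \<open>x\<close> would give the closed walk
      \<open>x p u v q\<close>.\<close>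
    have PQ: "\<not> (hasP x \<and> hasQ x)" for x
      using no5 uv adj_sym unfolding hasP_def hasQ_def P_def Q_def by blast
    \<comment> \<open>Neighbours \<open>p\<close> of \<open>x\<close> and \<open>p'\<close> of
      \<open>y\<close> in \<open>P\<close> would give the closed walk \<open>x p u p' y\<close>;
      likewise through \<open>v\<close> for \<open>Q\<close>.\<close>
    have PP: "\<not> (hasP x \<and> hasP y)" "\<not> (hasQ x \<and> hasQ y)" if "x \<sim> y" for x y
      using no5 that adj_sym unfolding hasP_def hasQ_def P_def Q_def by blast+
    have split: "bipartition (P \<union> X) (Q \<union> Y)"
      if "X \<union> Y = S" "X \<inter> Y = {}" "independent X" "independent Y"
        "\<And>x. x \<in> X \<Longrightarrow> \<not> hasP x" "\<And>x. x \<in> Y \<Longrightarrow> \<not> hasQ x" for X Y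
    proof -
      have "\<not> x \<sim> y" if "x \<in> P \<union> X" "y \<in> P \<union> X" for x y
        using that \<open>independent X\<close> indP \<open>\<And>x. x \<in> X \<Longrightarrow> \<not> hasP x\<close> adj_sym
        unfolding independent_def hasP_def by blast
      moreover have "\<not> x \<sim> y" if "x \<in> Q \<union> Y" "y \<in> Q \<union> Y" for x y
        using that \<open>independent Y\<close> indQ \<open>\<And>x. x \<in> Y \<Longrightarrow> \<not> hasQ x\<close> adj_sym
        unfolding independent_def hasQ_def by blast
      moreover have "(P \<union> X) \<union> (Q \<union> Y) = pverts G" "(P \<union> X) \<inter> (Q \<union> Y) = {}"
        using that(1,2) sub unfolding S_def by blast+
      ultimately show ?thesis
        unfolding bipartition_def independent_def by blast
    qed
    have ind1: "independent {x}" if "x \<in> S" for x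
      using that adj_irrefl by (auto simp: independent_def S_def)
    have ind0: "independent {}" by (simp add: independent_def)
    consider "S = {}" | x where "S = {x}" | x y where "x \<in> S" "y \<in> S" "x \<noteq> y" by blast
    then show ?thesis
    proof cases
      case 1
      then have "bipartition (P \<union> {}) (Q \<union> {})" by (intro split ind0) auto
      then show ?thesis by (rule that(1))
    next
      case 2
      show ?thesis
      proof (cases "hasP x")
        case True
        then have "bipartition (P \<union> {}) (Q \<union> {x})"
          using 2 PQ by (intro split ind0 ind1) auto
        then show ?thesis by (rule that(1))
      next
        case False
        then have "bipartition (P \<union> {x}) (Q \<union> {})"
          using 2 by (intro split ind0 ind1) auto
        then show ?thesis by (rule that(1))
      qed
    next
      case 3
      have xy: "x \<sim> y" using clique 3 by blast
      have "z = x \<or> z = y" if "z \<in> S" for z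
        using that 3 clique no_triangle by metis
      then have S: "S = {x, y}" using 3 by blast
      show ?thesis
      \<comment> \<open>Either disjunct rules out both \<open>hasP y\<close> and
        \<open>hasQ x\<close>, so \<open>y\<close> can join \<open>P\<close> and \<open>x\<close>
        can join \<open>Q\<close>. If both disjuncts fail, the opposite placement works.\<close>
      proof (cases "hasP x \<or> hasQ y")
        case True
        then have "\<not> hasP y \<and> \<not> hasQ x" using PQ PP[OF xy] by blast
        then have "bipartition (P \<union> {y}) (Q \<union> {x})"
          using S 3 by (intro split ind1) auto
        then show ?thesis by (rule that(1))
      next
        case False
        then have "bipartition (P \<union> {x}) (Q \<union> {y})"
          using S 3 by (intro split ind1) auto
        then show ?thesis by (rule that(1))
      qed
    qed
  qed
qed

section \<open>Colourings in which every colour occurs on both sides\<close>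

text \<open>Properness gives one direction. Conversely, a non-adjacent pair \<open>u\<close>,
  \<open>v\<close> of different colours would make \<open>u\<close> isolated, and an isolated vertex
  together with a suitable vertex of \<open>B\<close> completes any edge to a co-diamond.\<close>

lemma saturated_adj_iff:
  assumes bip: "bipartition A B" and c: "c \<in> colourings l G" and edge: "parcs G \<noteq> {}"
    and sat: "\<And>i. i \<in> {1..l} \<Longrightarrow> i \<in> c ` A \<and> i \<in> c ` B"
    and u: "u \<in> A" and v: "v \<in> B"
  shows "u \<sim> v \<longleftrightarrow> c u \<noteq> c v"
proof
  assume "u \<sim> v"
  then show "c u \<noteq> c v" using c colouring_proper by blast
next
  assume ne: "c u \<noteq> c v"
  have AV: "\<And>x. x \<in> A \<Longrightarrow> x \<in> pverts G" and BV: "\<And>x. x \<in> B \<Longrightarrow> x \<in> pverts G"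
    and A: "\<And>x y. x \<in> A \<Longrightarrow> y \<in> A \<Longrightarrow> \<not> x \<sim> y" and B: "\<And>x y. x \<in> B \<Longrightarrow> y \<in> B \<Longrightarrow> \<not> x \<sim> y"
    and cover: "\<And>x. x \<in> pverts G \<Longrightarrow> x \<in> A \<or> x \<in> B"
    using bip by (auto simp: bipartition_def independent_def)
  have partner: "\<exists>y \<in> B. c y = c x" if "x \<in> A" for x
    using sat[OF colouring_range[OF c AV[OF that]]] by force
  show "u \<sim> v"
  proof (rule ccontr)
    assume uv: "\<not> u \<sim> v"
    obtain v' where v': "v' \<in> B" "c v' = c u" using partner u by blast
    have uv': "\<not> u \<sim> v'" using colouring_proper[OF c] v' by metis
    \<comment> \<open>For an edge \<open>uw\<close>, the vertices \<open>v\<close> and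
      \<open>v'\<close> of \<open>B\<close> avoid \<open>w\<close> by lying on its side and avoid
      \<open>u\<close> by assumption and by colour, so they would be adjacent.\<close>
    have isolated: "\<not> u \<sim> w" for w
    proof
      assume uw: "u \<sim> w"
      then have w: "w \<in> B" using A u cover by (metis in_arcsD2)
      have "v \<sim> v'"
        using no_co_diamond[OF uw BV[OF v] BV[OF v'(1)]] uv uv' v v' w B ne adj_sym by metis
      then show False using B v v' by blast
    qed
    obtain x y where xy: "x \<in> A" "y \<in> B" "x \<sim> y"
    proof -
      obtain x y where "x \<sim> y" using edge by auto
      then show ?thesis
        using that A B cover adj_sym by (metis in_arcsD1 in_arcsD2)
    qed
    \<comment> \<open>\<open>y'\<close> avoids \<open>x\<close> by colour and \<open>y\<close> by
      side, so \<open>u\<close> and \<open>y'\<close> are both off the edge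
      \<open>xy\<close>.\<close>
    obtain y' where y': "y' \<in> B" "c y' = c x" using partner xy by blast
    have "\<not> y' \<sim> x" using colouring_proper[OF c] y' by metis
    moreover have "u \<noteq> y'" using u y' bip by (auto simp: bipartition_def)
    ultimately have "u \<sim> y'"
      using no_co_diamond[OF xy(3) AV[OF u] BV[OF y'(1)]] isolated B xy y' by blast
    then show False using isolated by blast
  qed
qed

text \<open>Two vertices of \<open>A\<close> with the same colour, together with an edge from a
  differently coloured \<open>z\<close> in \<open>A\<close> to a vertex \<open>v\<close> of their
  colour in \<open>B\<close>, would form a co-diamond.\<close>

lemma saturated_inj:
  assumes bip: "bipartition A B" and c: "c \<in> colourings l G" and edge: "parcs G \<noteq> {}"
    and sat: "\<And>i. i \<in> {1..l} \<Longrightarrow> i \<in> c ` A \<and> i \<in> c ` B"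
  shows "inj_on c A"
proof (rule inj_onI, rule ccontr)
  fix u u' assume u: "u \<in> A" "u' \<in> A" "c u = c u'" "u \<noteq> u'"
  have AV: "\<And>x. x \<in> A \<Longrightarrow> x \<in> pverts G" and BV: "\<And>x. x \<in> B \<Longrightarrow> x \<in> pverts G"
    and A: "\<And>x y. x \<in> A \<Longrightarrow> y \<in> A \<Longrightarrow> \<not> x \<sim> y"
    using bip by (auto simp: bipartition_def independent_def)
  have iff: "\<And>x y. x \<in> A \<Longrightarrow> y \<in> B \<Longrightarrow> x \<sim> y \<longleftrightarrow> c x \<noteq> c y"
    using saturated_adj_iff[OF bip c edge sat] by blast
  obtain v where v: "v \<in> B" "c v = c u"
    using sat[OF colouring_range[OF c AV[OF u(1)]]] by force
  \<comment> \<open>The ends of any edge have two colours, one of them not \<open>c u\<close>; by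
    saturation that colour also occurs on \<open>A\<close>.\<close>
  obtain z where z: "z \<in> A" "c z \<noteq> c u"
  proof -
    obtain x y where xy: "x \<sim> y" using edge by auto
    then obtain w where w: "w \<in> pverts G" "c w \<noteq> c u"
      using colouring_proper[OF c xy] by (metis in_arcsD1 in_arcsD2)
    then show ?thesis using that sat[OF colouring_range[OF c w(1)]] by force
  qed
  have "z \<sim> v" using iff z v by simp
  then have "u \<sim> u'"
    using no_co_diamond[of z v u u'] u z v A iff AV by metis
  then show False using A u by blast
qed

text \<open>\<open>c\<close> maps each side bijectively onto the colours, and vertices on opposite
  sides are adjacent exactly if their colours differ. The deleted matching \<open>M\<close> thus
  joins the pairs of equal colour.\<close>

lemma saturated_iso:
  assumes bip: "bipartition A B" and c: "c \<in> colourings l G" and edge: "parcs G \<noteq> {}"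
    and sat: "\<And>i. i \<in> {1..l} \<Longrightarrow> i \<in> c ` A \<and> i \<in> c ` B"
  shows "\<exists>M. perfect_matching (complete_bipartite_graph l l) M \<and>
             graph_iso G (delete_edges (complete_bipartite_graph l l) M)"
proof -
  define M :: "(nat + nat) rel" where
    "M = {(Inl i, Inr i) |i. i < l} \<union> {(Inr i, Inl i) |i. i < l}"
  let ?K = "complete_bipartite_graph l l"
  let ?H = "delete_edges ?K M"
  have PM: "perfect_matching ?K M"
    unfolding perfect_matching_def complete_bipartite_graph_def Let_def M_def
    by (auto simp: sym_def)
  \<comment> \<open>Colours start at 1 but the vertices of
    \<open>complete_bipartite_graph l l\<close> are indexed from 0, hence the shift.\<close>
  define f :: "'a \<Rightarrow> nat + nat" where "f v = (if v \<in> A then Inl (c v - 1) else Inr (c v - 1))" for v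
  have iff: "x \<sim> y \<longleftrightarrow> c x \<noteq> c y" if "x \<in> A" "y \<in> B" for x y
    using saturated_adj_iff[OF bip c edge sat that] .
  have iff': "y \<sim> x \<longleftrightarrow> c x \<noteq> c y" if "x \<in> A" "y \<in> B" for x y
    using iff[OF that] adj_sym by blast
  have injA: "inj_on c A" using saturated_inj[OF bip c edge sat] .
  have injB: "inj_on c B"
    by (rule saturated_inj[OF bipartition_sym[OF bip] c edge]) (use sat in blast)
  have V: "pverts G = A \<union> B" "A \<inter> B = {}" "\<And>x y. x \<in> A \<Longrightarrow> y \<in> A \<Longrightarrow> \<not> x \<sim> y"
    "\<And>x y. x \<in> B \<Longrightarrow> y \<in> B \<Longrightarrow> \<not> x \<sim> y"
    using bip by (auto simp: bipartition_def independent_def)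
  have fA: "f v = Inl (c v - 1)" if "v \<in> A" for v using that by (simp add: f_def)
  have fB: "f v = Inr (c v - 1)" if "v \<in> B" for v using that V(2) by (auto simp: f_def)
  have cr: "1 \<le> c v \<and> c v \<le> l" if "v \<in> pverts G" for v
    using colouring_range[OF c that] by simp
  have eq: "c x - 1 = c y - 1 \<longleftrightarrow> c x = c y" if "x \<in> pverts G" "y \<in> pverts G" for x y
    using cr[OF that(1)] cr[OF that(2)] by auto
  have pred: "\<exists>x \<in> X. i = c x - 1" if "i < l" "X = A \<or> X = B" for i X
    using sat[of "Suc i"] that by force
  have "graph_iso G ?H"
  proof (rule graph_isoI)
    show "pair_wf_digraph G" by unfold_locales
    show "pair_wf_digraph ?H"
      by unfold_locales (auto simp: delete_edges_def complete_bipartite_graph_def Let_def)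
    have "inj_on f (pverts G)"
    proof (rule inj_onI)
      fix x y assume xy: "x \<in> pverts G" "y \<in> pverts G" "f x = f y"
      then have "c x = c y" using eq[OF xy(1,2)] V by (auto simp: f_def split: if_splits)
      moreover have "x \<in> A \<and> y \<in> A \<or> x \<in> B \<and> y \<in> B"
        using xy V by (auto simp: f_def split: if_splits)
      ultimately show "x = y" using injA injB by (auto dest: inj_onD)
    qed
    moreover have "f ` pverts G = pverts ?H"
    proof
      show "f ` pverts G \<subseteq> pverts ?H"
        using cr by (force simp: f_def delete_edges_def complete_bipartite_graph_def Let_def)
      show "pverts ?H \<subseteq> f ` pverts G"
      proof
        fix w assume "w \<in> pverts ?H"
        then consider i where "w = Inl i" "i < l" | i where "w = Inr i" "i < l"
          by (auto simp: delete_edges_def complete_bipartite_graph_def Let_def)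
        then show "w \<in> f ` pverts G"
        proof cases
          case 1 then show ?thesis using pred[OF 1(2), of A] fA V(1) by force
        next
          case 2 then show ?thesis using pred[OF 2(2), of B] fB V(1) by force
        qed
      qed
    qed
    ultimately show "bij_betw f (pverts G) (pverts ?H)"
      by (simp add: bij_betw_def)
    have arcsH: "parcs ?H =
      {(Inl i, Inr j) |i j. i < l \<and> j < l \<and> i \<noteq> j} \<union> {(Inr i, Inl j) |i j. i < l \<and> j < l \<and> i \<noteq> j}"
      by (auto simp: delete_edges_def complete_bipartite_graph_def Let_def M_def)
    have lt: "c v - 1 < l" if "v \<in> pverts G" for v using cr[OF that] by auto
    show "(f x, f y) \<in> parcs ?H \<longleftrightarrow> x \<sim> y" if xy: "x \<in> pverts G" "y \<in> pverts G" for x y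
    proof -
      consider "x \<in> A" "y \<in> A" | "x \<in> A" "y \<in> B" | "x \<in> B" "y \<in> A" | "x \<in> B" "y \<in> B"
        using xy V(1) by blast
      then show ?thesis
      proof cases
        case 1 then show ?thesis using V(3) by (simp add: arcsH fA)
      next
        case 2 then show ?thesis using iff lt xy eq by (simp add: arcsH fA fB)
      next
        case 3 then show ?thesis using iff' lt xy eq by (auto simp add: arcsH fA fB)
      next
        case 4 then show ?thesis using V(4) by (simp add: arcsH fB)
      qed
    qed
  qed
  with PM show ?thesis by blast
qed

section \<open>Combining the cases into one distance bound\<close>

lemma reach_three:
  assumes l: "chromatic_number G + 1 \<le> l"
    and noniso: "\<not> (\<exists>M. perfect_matching (complete_bipartite_graph l l) M \<and>
                        graph_iso G (delete_edges (complete_bipartite_graph l l) M))"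
    and c: "c \<in> colourings l G" and d: "d \<in> colourings l G"
  shows "reach l (3 * card (pverts G)) c d"
proof (cases "parcs G = {}")
  case True
  have "reach l (card (pverts G)) c d"
    \<comment> \<open>Without edges the whole vertex set is independent, and off it both colourings
      are \<open>undefined\<close>.\<close>
    by (rule reach_independent[OF _ c d])
      (use True colouring_extensional[OF c] colouring_extensional[OF d] in
        \<open>auto simp: independent_def extensional_def\<close>)
  then show ?thesis by (rule reach_mono) simp
next
  case False
  obtain k where k: "k \<in> colourings (chromatic_number G) G"
    using chromatic_number_colourable by blast
  obtain u v where uv: "u \<sim> v" using False by auto
  have "2 \<le> chromatic_number G"
    using colouring_proper[OF k uv] colouring_range[OF k in_arcsD1[OF uv]]
      colouring_range[OF k in_arcsD2[OF uv]] by auto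
  then have l3: "3 \<le> l" using l by simp
  show ?thesis
  proof (cases "colourings 2 G = {}")
    case True
    then have "\<not> chromatic_number G \<le> 2"
      using colourings_mono[of "chromatic_number G" 2] k by blast
    then have "2 + 2 \<le> l" using l by simp
    moreover obtain a1 a2 a3 a4 a5 where
      C: "a1 \<sim> a2" "a2 \<sim> a3" "a3 \<sim> a4" "a4 \<sim> a5" "a5 \<sim> a1"
      using bipartite_or_five_cycle bipartition_colouring True by metis
    \<comment> \<open>With \<open>D = 2\<close>, the bound \<open>(D + 1) * card (pverts G)\<close>
      is the required one.\<close>
    ultimately show ?thesis
      using reach_max_degree[OF five_cycle_degree[OF C] _ c d] by (simp add: numeral_3_eq_3)
  next
    case two: False
    obtain A B where bip: "bipartition A B" using colouring_bipartition[OF two] .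
    have unsat: "\<exists>i. i \<in> {1..l} \<and> (i \<notin> c' ` A \<or> i \<notin> c' ` B)" if "c' \<in> colourings l G" for c'
      using saturated_iso[OF bip that False] noniso by blast
    obtain i where i: "i \<in> {1..l}" "i \<notin> c ` A \<or> i \<notin> c ` B" using unsat[OF c] by blast
    obtain j where j: "j \<in> {1..l}" "j \<notin> d ` A \<or> j \<notin> d ` B" using unsat[OF d] by blast
    from i(2) show ?thesis
    proof
      assume "i \<notin> c ` B"
      then show ?thesis using reach_bipartite[OF bip l3 c d i(1) _ j] by blast
    next
      assume "i \<notin> c ` A"
      \<comment> \<open>The sides are swapped to put the missing colour of \<open>c\<close> on the
        second side; the condition on \<open>j\<close> is symmetric in them.\<close>
      then show ?thesis
        using reach_bipartite[OF bipartition_sym[OF bip] l3 c d i(1) _ j(1)] j(2) by blast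
    qed
  qed
qed

end

theorem corollary5:
  fixes G :: "'a pair_pre_digraph" and l :: nat
  assumes "pair_graph G"
    and "induced_free triangle_graph G"
    and "induced_free co_diamond G"
    and "l \<ge> chromatic_number G + 1"
    and "\<not> (\<exists>M. perfect_matching (complete_bipartite_graph l l) M \<and>
               graph_iso G (delete_edges (complete_bipartite_graph l l) M))"
  shows "diameter (recolouring_graph l G) \<le> ereal (of_int \<lfloor>(5 + 1/2) * real (card (pverts G))\<rfloor>)"
proof -
  interpret triangle_co_diamond_free G
    using assms(1-3) by (simp add: triangle_co_diamond_free_def triangle_co_diamond_free_axioms_def)
  interpret R: pair_graph "recolouring_graph l G"
    using assms(1) by (rule pair_graph_recolouring_graph)
  have "diameter (recolouring_graph l G) \<le> ereal (real (3 * card (pverts G)))"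
    using reach_three[OF assms(4,5)]
    by (subst diameter_le_iff[OF R.pair_wf_digraph_axioms])
      (simp add: reach_def recolouring_graph_def)
  \<comment> \<open>The floor costs nothing, since \<open>3 * card (pverts G)\<close> is an
    integer.\<close>
  also have "int (3 * card (pverts G)) \<le> \<lfloor>(5 + 1/2) * real (card (pverts G))\<rfloor>"
    by (subst le_floor_iff) simp
  then have "ereal (real (3 * card (pverts G)))
      \<le> ereal (of_int \<lfloor>(5 + 1/2) * real (card (pverts G))\<rfloor>)"
    by (metis ereal_less_eq(3) of_int_le_iff of_int_of_nat_eq)
  finally show ?thesis .
qed

end
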